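(* Let $m$ and $n$ be positive integers and let $C_1$ and $C_2$ be two cycles on the $m \times n$ grid with the same signature. Then the size of the difference between $C_1$ and $C_2$ is divisible by $8$.
   Context: The $m \times n$ grid is the plane graph whose vertices are the integer points $(x, y)$ with $1 \le x \le m$ and $1 \le y \le n$ and whose edges are the unit segments between these points; its finite faces are the unit square cells. The signature of a cycle $C$ on the grid is the function assigning to each cell the number of edges of that cell which belong to $C$. The difference between two cycles is the set of all edges which are part of exactly one of the two cycles (the symmetric difference of their edge sets). *)

theory Defs
  imports Main "HOL-Library.FuncSet"
begin

type_synonym point = "int \<times> int"

definition grid_vertices :: "nat \<Rightarrow> nat \<Rightarrow> point set" where
  "grid_vertices m n = {1..int m} \<times> {1..int n}"

text \<open>An undirected edge is the set of its two endpoints.\<close>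

definition grid_edges :: "nat \<Rightarrow> nat \<Rightarrow> point set set" where
  "grid_edges m n =
     {{(x, y), (x + 1, y)} | x y. (x, y) \<in> grid_vertices m n \<and> (x + 1, y) \<in> grid_vertices m n} \<union>
     {{(x, y), (x, y + 1)} | x y. (x, y) \<in> grid_vertices m n \<and> (x, y + 1) \<in> grid_vertices m n}"

text \<open>A unit square cell is represented by its lower left corner.\<close>

definition grid_cells :: "nat \<Rightarrow> nat \<Rightarrow> point set" where
  "grid_cells m n = {1..<int m} \<times> {1..<int n}"

fun cell_edges :: "point \<Rightarrow> point set set" where
  "cell_edges (x, y) =
     {{(x, y), (x + 1, y)}, {(x, y + 1), (x + 1, y + 1)},
      {(x, y), (x, y + 1)}, {(x + 1, y), (x + 1, y + 1)}}"

text \<open>A cycle is given by its set of edges; it traverses at least three pairwise distinct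
  vertices in cyclic order.\<close>

definition cycle_edges :: "'a list \<Rightarrow> 'a set set" where
  "cycle_edges vs = {{vs ! i, vs ! (Suc i mod length vs)} | i. i < length vs}"

definition grid_cycle :: "nat \<Rightarrow> nat \<Rightarrow> point set set \<Rightarrow> bool" where
  "grid_cycle m n C \<longleftrightarrow>
     (\<exists>vs. 3 \<le> length vs \<and> distinct vs \<and> set vs \<subseteq> grid_vertices m n \<and>
        cycle_edges vs \<subseteq> grid_edges m n \<and> C = cycle_edges vs)"

text \<open>The signature is a function on the cells of the grid; outside them it is undefined
  in the sense of restrict, so that equality of signatures only concerns the cells.\<close>

definition signature :: "nat \<Rightarrow> nat \<Rightarrow> point set set \<Rightarrow> point \<Rightarrow> nat" where
  "signature m n C = (\<lambda>c\<in>grid_cells m n. card (cell_edges c \<inter> C))"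

definition cycle_difference :: "'a set set \<Rightarrow> 'a set set \<Rightarrow> 'a set set" where
  "cycle_difference C D = (C - D) \<union> (D - C)"

end

theory Submission
  imports Defs
begin

text \<open>
  Let \<open>A\<^sub>1\<close>, \<open>A\<^sub>2\<close> be the sets of cells inside the two cycles, \<open>\<gamma>\<close> the indicator of their symmetric
  difference and \<open>h = A\<^sub>1 + A\<^sub>2 - 1\<close> (identifying sets with indicators), so \<open>h = - 1\<close> outside the grid.
  An edge lies in the difference of the cycles iff \<open>\<gamma>\<close> differs on its two sides. Write \<open>L f\<close> for the
  sum of \<open>f\<close> over the four neighbours of a cell. Equality of the signatures gives \<open>L h = 0\<close> where
  \<open>\<gamma> = 1\<close>, and \<open>L \<gamma>\<close> even on every cell.

  Modulo 2, \<open>\<gamma>\<close> solves the discrete wave equation with zero boundary values, so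
  \<open>\<gamma> x y = X (x + y) - X (x - y)\<close> modulo 2 for a function \<open>X\<close> with values 0 and 1; therefore
  \<open>w x y = (-1)^y * (X (x + y) - X (x - y))\<close> is a lift of \<open>\<gamma>\<close> to \<open>{-1, 0, 1}\<close> with \<open>L w = 0\<close>
  on every cell, over the integers.

  Put \<open>z = 1 - w\<^sup>2\<close>. As \<open>L\<close> is self-adjoint, \<open>0 = \<Sum> w * L h = \<Sum> h * L w\<close>, where only cells outside the
  grid contribute; there \<open>h = - 1\<close> and \<open>z = 1\<close>, whence \<open>\<Sum> w * L z = \<Sum> z * L w = 0\<close>. The size of the
  difference is \<open>\<Sum> w\<^sup>2 * L z\<close>, which is thus twice the sum of \<open>L z\<close> over the cells with \<open>w = - 1\<close>.
  With \<open>\<nu>\<close> the indicator of these cells, \<open>L w = 0\<close> yields \<open>L z = 4 - 2 * L \<nu>\<close>, and \<open>\<Sum> \<nu> * L \<nu>\<close> is even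
  since it counts every adjacent pair twice.
\<close>

section \<open>Neighbour sums and summation by parts\<close>

definition nbr_sum :: "(int \<Rightarrow> int \<Rightarrow> int) \<Rightarrow> int \<Rightarrow> int \<Rightarrow> int" where
  "nbr_sum f x y = f (x + 1) y + f (x - 1) y + f x (y + 1) + f x (y - 1)"

text \<open>The support of \<open>f\<close> is interior, so the shift keeps it in the closed
  rectangle and no boundary terms arise. \<open>g\<close> stays arbitrary on the boundary, as its
  use for \<open>h\<close> requires.\<close>

lemma sum_shift:
  fixes f g :: "int \<Rightarrow> int \<Rightarrow> int"
  assumes supp: "\<And>x y. f x y \<noteq> 0 \<Longrightarrow> 0 < x \<and> x < m \<and> 0 < y \<and> y < n"
    and ab: "\<bar>a\<bar> \<le> 1" "\<bar>b\<bar> \<le> 1"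
  shows "(\<Sum>(x, y)\<in>{0..m} \<times> {0..n}. f x y * g (x + a) (y + b))
       = (\<Sum>(x, y)\<in>{0..m} \<times> {0..n}. f (x - a) (y - b) * g x y)"
proof -
  let ?K = "{0..m} \<times> {0..n}" and ?I = "{0<..<m} \<times> {0<..<n}"
  have "(\<Sum>(x, y)\<in>?K. f x y * g (x + a) (y + b)) = (\<Sum>(x, y)\<in>?I. f x y * g (x + a) (y + b))"
    using supp by (intro sum.mono_neutral_right) fastforce+
  also have "\<dots> = (\<Sum>(x, y)\<in>(\<lambda>(x, y). (x + a, y + b)) ` ?I. f (x - a) (y - b) * g x y)"
    by (subst sum.reindex) (auto simp: inj_on_def intro!: sum.cong)
  also have "\<dots> = (\<Sum>(x, y)\<in>?K. f (x - a) (y - b) * g x y)"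
  proof (intro sum.mono_neutral_left ballI)
    fix p assume p: "p \<in> ?K - (\<lambda>(x, y). (x + a, y + b)) ` ?I"
    have "(fst p - a, snd p - b) \<notin> ?I"
      using p image_eqI[of p "\<lambda>(x, y). (x + a, y + b)" "(fst p - a, snd p - b)" ?I] by auto
    then show "(case p of (x, y) \<Rightarrow> f (x - a) (y - b) * g x y) = 0"
      using supp[of "fst p - a" "snd p - b"] by (auto simp: split_def)
  qed (use ab in auto)
  finally show ?thesis .
qed

lemma nbr_sum_adjoint:
  fixes f g :: "int \<Rightarrow> int \<Rightarrow> int"
  assumes supp: "\<And>x y. f x y \<noteq> 0 \<Longrightarrow> 0 < x \<and> x < m \<and> 0 < y \<and> y < n"
  shows "(\<Sum>(x, y)\<in>{0..m} \<times> {0..n}. f x y * nbr_sum g x y)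
       = (\<Sum>(x, y)\<in>{0..m} \<times> {0..n}. nbr_sum f x y * g x y)"
  using sum_shift[of f m n 1 0 g, OF supp] sum_shift[of f m n "-1" 0 g, OF supp]
    sum_shift[of f m n 0 1 g, OF supp] sum_shift[of f m n 0 "-1" g, OF supp]
  by (simp add: nbr_sum_def distrib_left distrib_right split_def sum.distrib)

lemma even_sum_nbr_sum:
  fixes f :: "int \<Rightarrow> int \<Rightarrow> int"
  assumes supp: "\<And>x y. f x y \<noteq> 0 \<Longrightarrow> 0 < x \<and> x < m \<and> 0 < y \<and> y < n"
  shows "even (\<Sum>(x, y)\<in>{0..m} \<times> {0..n}. f x y * nbr_sum f x y)"
  using sum_shift[of f m n 1 0 f, OF supp] sum_shift[of f m n 0 1 f, OF supp]
  by (simp add: nbr_sum_def distrib_left split_def sum.distrib mult.commute)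

lemma eight_dvd_sum_nbr_sum:
  fixes w h :: "int \<Rightarrow> int \<Rightarrow> int"
  assumes range: "\<And>x y. w x y \<in> {-1, 0, 1}"
    and supp: "\<And>x y. w x y \<noteq> 0 \<Longrightarrow> 0 < x \<and> x < m \<and> 0 < y \<and> y < n"
    and harm: "\<And>x y. 0 < x \<Longrightarrow> x < m \<Longrightarrow> 0 < y \<Longrightarrow> y < n \<Longrightarrow> nbr_sum w x y = 0"
    and h_boundary: "\<And>x y. x \<in> {0, m} \<or> y \<in> {0, n} \<Longrightarrow> h x y = - 1"
    and h_nbrs: "\<And>x y. w x y \<noteq> 0 \<Longrightarrow> nbr_sum h x y = 0"
  shows "8 dvd (\<Sum>(x, y)\<in>{0..m} \<times> {0..n}. (w x y)\<^sup>2 * nbr_sum (\<lambda>x y. 1 - (w x y)\<^sup>2) x y)"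
proof -
  let ?K = "{0..m} \<times> {0..n}"
  define z where "z = (\<lambda>x y. 1 - (w x y)\<^sup>2)"
  define \<nu> where "\<nu> = (\<lambda>x y. of_bool (w x y = - 1) :: int)"
  have \<nu>_supp: "0 < x \<and> x < m \<and> 0 < y \<and> y < n" if "\<nu> x y \<noteq> 0" for x y
    using that by (intro supp) (auto simp: \<nu>_def)
  have z_boundary: "z x y = 1" if "x \<in> {0, m} \<or> y \<in> {0, n}" for x y
    using that supp[of x y] by (auto simp: z_def)
  have "(\<Sum>(x, y)\<in>?K. w x y * nbr_sum z x y) = (\<Sum>(x, y)\<in>?K. nbr_sum w x y * z x y)"
    by (rule nbr_sum_adjoint[OF supp])
  also have "\<dots> = (\<Sum>(x, y)\<in>?K. - (nbr_sum w x y * h x y))"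
  proof (intro sum.cong refl, clarify)
    fix x y assume "x \<in> {0..m}" "y \<in> {0..n}"
    then show "nbr_sum w x y * z x y = - (nbr_sum w x y * h x y)"
      using harm[of x y] z_boundary[of x y] h_boundary[of x y] by fastforce
  qed
  also have "\<dots> = - (\<Sum>(x, y)\<in>?K. w x y * nbr_sum h x y)"
    using nbr_sum_adjoint[of w m n h, OF supp] by (simp add: sum_negf split_def)
  also have "(\<Sum>(x, y)\<in>?K. w x y * nbr_sum h x y) = 0"
    using h_nbrs by (intro sum.neutral) auto
  finally have wz: "(\<Sum>(x, y)\<in>?K. w x y * nbr_sum z x y) = 0" by simp
  have \<nu>z: "\<nu> x y * nbr_sum z x y = 4 * \<nu> x y - 2 * (\<nu> x y * nbr_sum \<nu> x y)" for x y
  proof (cases "\<nu> x y = 0")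
    case False
    \<comment> \<open>On {-1, 0, 1} the square of \<open>w\<close> is \<open>w + 2 * \<nu>\<close>,
      so \<open>z\<close> becomes affine in \<open>w\<close> and \<open>\<nu>\<close>.\<close>
    have zw: "z x y = 1 - w x y - 2 * \<nu> x y" for x y
      using range[of x y] by (auto simp: z_def \<nu>_def)
    have "nbr_sum z x y = 4 - nbr_sum w x y - 2 * nbr_sum \<nu> x y"
      by (simp add: nbr_sum_def zw)
    then have "nbr_sum z x y = 4 - 2 * nbr_sum \<nu> x y"
      using harm[of x y] \<nu>_supp[OF False] by simp
    then show ?thesis
      by (simp only: right_diff_distrib mult.left_commute mult.commute)
  qed simp
  have sq: "(w x y)\<^sup>2 * nbr_sum z x y = w x y * nbr_sum z x y + 2 * (\<nu> x y * nbr_sum z x y)" for x y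
    using range[of x y] by (auto simp: \<nu>_def)
  have "(\<Sum>(x, y)\<in>?K. (w x y)\<^sup>2 * nbr_sum z x y) = 2 * (\<Sum>(x, y)\<in>?K. \<nu> x y * nbr_sum z x y)"
    using wz by (simp add: sq sum.distrib split_def flip: sum_distrib_left)
  also have "(\<Sum>(x, y)\<in>?K. \<nu> x y * nbr_sum z x y)
      = 4 * (\<Sum>(x, y)\<in>?K. \<nu> x y) - 2 * (\<Sum>(x, y)\<in>?K. \<nu> x y * nbr_sum \<nu> x y)"
    by (simp add: \<nu>z sum_subtractf split_def flip: sum_distrib_left)
  also obtain k where "(\<Sum>(x, y)\<in>?K. \<nu> x y * nbr_sum \<nu> x y) = 2 * k"
    using even_sum_nbr_sum[of \<nu> m n] \<nu>_supp by (blast elim: evenE)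
  finally show ?thesis by (simp add: z_def)
qed

section \<open>Integer lifts through the discrete wave equation\<close>

text \<open>The values of \<open>X\<close> on \<open>{0..m}\<close>, read off from the first row \<open>b\<close> of \<open>\<gamma>\<close>; reflection in \<open>0\<close> and \<open>m\<close>
  extends them to all integers.\<close>

fun diagonal :: "(int \<Rightarrow> bool) \<Rightarrow> nat \<Rightarrow> bool" where
  "diagonal b 0 = False"
| "diagonal b (Suc 0) = False"
| "diagonal b (Suc (Suc k)) = (diagonal b k \<noteq> b (int k + 1))"

text \<open>The row conditions only link arguments in \<open>{0..m}\<close> that are two apart, so
  each parity class is filled in from a free starting value; the reflections then only prescribe
  values elsewhere.\<close>

lemma diagonal_exists:
  fixes b :: "int \<Rightarrow> bool"
  assumes "0 < m"
  obtains X :: "int \<Rightarrow> bool" where "\<And>k. X (- k) = X k" and "\<And>k. X (m + k) = X (m - k)"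
    and "\<And>k. 0 < k \<Longrightarrow> k < m \<Longrightarrow> b k \<longleftrightarrow> X (k + 1) \<noteq> X (k - 1)"
proof -
  \<comment> \<open>The distance from \<open>k\<close> to the nearest multiple of
    \<open>2 * m\<close>, which folds the integers onto \<open>{0..m}\<close>.\<close>
  define r where "r k = min (k mod (2 * m)) (- k mod (2 * m))" for k :: int
  have r_id: "r k = k" if "0 \<le> k" "k \<le> m" for k
    using that assms by (cases "k = 0") (auto simp: r_def zmod_zminus1_eq_if)
  have r_minus: "r (- k) = r k" for k
    by (simp add: r_def min.commute)
  have "r (m + k) = r (m - k)" for k
  proof -
    have "(m + k) mod (2 * m) = - (m - k) mod (2 * m)"
      "- (m + k) mod (2 * m) = (m - k) mod (2 * m)"
      using mod_add_self2[of "- (m - k)" "2 * m"] mod_add_self2[of "- (m + k)" "2 * m"]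
      by (simp_all add: algebra_simps)
    then show ?thesis by (simp add: r_def min.commute)
  qed
  moreover have "b k \<longleftrightarrow> diagonal b (nat (r (k + 1))) \<noteq> diagonal b (nat (r (k - 1)))"
    if "0 < k" "k < m" for k
  proof -
    define l where "l = nat (k - 1)"
    have "nat (r (k + 1)) = Suc (Suc l)" "nat (r (k - 1)) = l" "k = int l + 1"
      using that by (auto simp: r_id l_def)
    then show ?thesis by auto
  qed
  ultimately show ?thesis
    by (intro that[of "\<lambda>k. diagonal b (nat (r k))"]) (simp_all only: r_minus)
qed

lemma harmonic_lift:
  fixes \<gamma> :: "int \<Rightarrow> int \<Rightarrow> bool"
  assumes "0 < m" "0 < n"
    and boundary: "\<And>x y. x \<in> {0, m} \<or> y \<in> {0, n} \<Longrightarrow> \<not> \<gamma> x y"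
    and even_nbrs: "\<And>x y. 0 < x \<Longrightarrow> x < m \<Longrightarrow> 0 < y \<Longrightarrow> y < n \<Longrightarrow>
      even (nbr_sum (\<lambda>x y. of_bool (\<gamma> x y)) x y)"
  obtains w :: "int \<Rightarrow> int \<Rightarrow> int" where "\<And>x y. w x y \<in> {-1, 0, 1}"
    and "\<And>x y. w x y \<noteq> 0 \<longleftrightarrow> 0 < x \<and> x < m \<and> 0 < y \<and> y < n \<and> \<gamma> x y"
    and "\<And>x y. 0 < x \<Longrightarrow> x < m \<Longrightarrow> 0 < y \<Longrightarrow> y < n \<Longrightarrow> nbr_sum w x y = 0"
proof -
  obtain X :: "int \<Rightarrow> bool" where X_minus: "\<And>k. X (- k) = X k" and X_refl: "\<And>k. X (m + k) = X (m - k)"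
    and X_row: "\<And>k. 0 < k \<Longrightarrow> k < m \<Longrightarrow> \<gamma> k 1 \<longleftrightarrow> X (k + 1) \<noteq> X (k - 1)"
    using diagonal_exists[OF \<open>0 < m\<close>, of "\<lambda>k. \<gamma> k 1"] by blast
  \<comment> \<open>The recursion below works at inner columns only; on the two side columns the
    symmetries of \<open>X\<close> settle the claim.\<close>
  have edge: "\<gamma> x y \<longleftrightarrow> X (x + y) \<noteq> X (x - y)" if "x \<in> {0, m}" for x y
    using that X_minus[of y] X_refl[of y] boundary[of x y] by auto
  have \<gamma>_nat: "int j \<le> n \<Longrightarrow> \<forall>x. 0 \<le> x \<and> x \<le> m \<longrightarrow> (\<gamma> x (int j) \<longleftrightarrow> X (x + int j) \<noteq> X (x - int j))" for j
  proof (induction j rule: induct_nat_012)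
    case 0
    then show ?case using boundary by simp
  next
    case 1
    then show ?case using X_row edge by (metis insert_iff less_le of_nat_1 One_nat_def)
  next
    case (ge2 j)
    show ?case
    proof (intro allI impI)
      fix x assume x: "0 \<le> x \<and> x \<le> m"
      show "\<gamma> x (int (Suc (Suc j))) \<longleftrightarrow> X (x + int (Suc (Suc j))) \<noteq> X (x - int (Suc (Suc j)))"
      proof (cases "x \<in> {0, m}")
        case False
        then have x': "0 < x" "x < m" using x by auto
        define y where "y = int j + 1"
        have y: "int j = y - 1" "int (Suc j) = y" "int (Suc (Suc j)) = y + 1" "0 < y" "y < n"
          using ge2.prems by (auto simp: y_def)
        have IH: "\<gamma> u y \<longleftrightarrow> X (u + y) \<noteq> X (u - y)" if "0 \<le> u" "u \<le> m" for u
          using ge2.IH(2) that y by simp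
        have "\<gamma> x (y - 1) \<longleftrightarrow> X (x + y - 1) \<noteq> X (x - y + 1)"
          using ge2.IH(1) x y by (simp add: algebra_simps)
        moreover have "\<gamma> (x + 1) y \<longleftrightarrow> X (x + y + 1) \<noteq> X (x - y + 1)"
          using IH[of "x + 1"] x' by (simp add: algebra_simps)
        moreover have "\<gamma> (x - 1) y \<longleftrightarrow> X (x + y - 1) \<noteq> X (x - y - 1)"
          using IH[of "x - 1"] x' by (simp add: algebra_simps)
        \<comment> \<open>The parity condition solved for the upper neighbour: a wave equation step
          with \<open>y\<close> as time. On substitution \<open>X (x + y - 1)\<close> and
          \<open>X (x - y + 1)\<close> cancel.\<close>
        moreover have "\<gamma> x (y + 1) \<longleftrightarrow> (\<gamma> (x + 1) y \<noteq> (\<gamma> (x - 1) y \<noteq> \<gamma> x (y - 1)))"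
          using even_nbrs[OF x' y(4,5)] by (auto simp: nbr_sum_def)
        ultimately have "\<gamma> x (y + 1) \<longleftrightarrow> X (x + y + 1) \<noteq> X (x - y - 1)"
          by blast
        then show ?thesis unfolding y by (simp add: algebra_simps)
      qed (rule edge)
    qed
  qed
  have \<gamma>: "\<gamma> x y \<longleftrightarrow> X (x + y) \<noteq> X (x - y)" if "0 \<le> x" "x \<le> m" "0 \<le> y" "y \<le> n" for x y
    using \<gamma>_nat[of "nat y"] that by simp
  define v :: "int \<Rightarrow> int \<Rightarrow> int"
    where "v x y = (if even y then 1 else -1) * (of_bool (X (x + y)) - of_bool (X (x - y)))" for x y
  define w where "w x y = (if 0 < x \<and> x < m \<and> 0 < y \<and> y < n then v x y else 0)" for x y
  \<comment> \<open>The formula for \<open>\<gamma>\<close> reaches row \<open>n\<close>, so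
    \<open>v\<close> vanishes on the whole boundary and the cut-off leaves neighbour sums at inner
    cells unchanged.\<close>
  have wv: "w x y = v x y" if "0 \<le> x" "x \<le> m" "0 \<le> y" "y \<le> n" for x y
    using that \<gamma>[OF that] boundary[of x y] by (auto simp: w_def v_def)
  have "nbr_sum w x y = 0" if "0 < x" "x < m" "0 < y" "y < n" for x y
  proof -
    have "nbr_sum w x y = nbr_sum v x y"
      using that by (simp add: nbr_sum_def wv)
    \<comment> \<open>The sign alternates with \<open>y\<close>, so vertical neighbours carry the
      same four values of \<open>X\<close> as horizontal ones, with opposite signs.\<close>
    also have "\<dots> = 0"
      by (simp add: nbr_sum_def v_def algebra_simps)
    finally show ?thesis .
  qed
  moreover have "w x y \<in> {-1, 0, 1}" for x y
    by (auto simp: w_def v_def)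
  moreover have "w x y \<noteq> 0 \<longleftrightarrow> 0 < x \<and> x < m \<and> 0 < y \<and> y < n \<and> \<gamma> x y" for x y
    using \<gamma>[of x y] by (auto simp: w_def v_def)
  ultimately show ?thesis by (rule that[rotated 2])
qed

lemma card_of_bool4:
  assumes "distinct [a, b, c, d]"
  shows "card ({a, b, c, d} \<inter> C)
    = of_bool (a \<in> C) + of_bool (b \<in> C) + of_bool (c \<in> C) + of_bool (d \<in> C)"
  using assms by (auto simp: Int_insert_left)

text \<open>A vertex on the cycle meets exactly the edges starting at its index \<open>k\<close> and
  at the cyclic predecessor \<open>p\<close>; these differ because the length is at least 3.\<close>

lemma even_card_incident_cycle_edges:
  assumes "distinct vs" "3 \<le> length vs"
  shows "even (card {e \<in> cycle_edges vs. v \<in> e})"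
proof (cases "v \<in> set vs")
  case False
  have "{e \<in> cycle_edges vs. v \<in> e} = {}"
  proof -
    have "vs ! i \<in> set vs" "vs ! (Suc i mod length vs) \<in> set vs" if "i < length vs" for i
      using that by (auto intro!: nth_mem mod_less_divisor)
    then show ?thesis using False by (auto simp: cycle_edges_def)
  qed
  then show ?thesis by (simp only: card.empty even_zero)
next
  case True
  define L where "L = length vs"
  define edge where "edge i = {vs ! i, vs ! (Suc i mod L)}" for i
  obtain k where k: "k < L" "v = vs ! k"
    using True by (auto simp: in_set_conv_nth L_def)
  define p where "p = (if k = 0 then L - 1 else k - 1)"
  have L: "3 \<le> L" using assms by (simp add: L_def)
  have p: "p < L" "Suc p mod L = k" "p \<noteq> k" "Suc k mod L \<noteq> p" "Suc k mod L \<noteq> k"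
    using L k by (auto simp: p_def mod_Suc)
  have eq: "vs ! i = vs ! j \<longleftrightarrow> i = j" if "i < L" "j < L" for i j
    using that assms by (simp add: nth_eq_iff_index_eq L_def)
  have pred: "i = p" if "i < L" "Suc i mod L = k" for i
    using that k L by (auto simp: p_def mod_Suc split: if_splits)
  have lt: "Suc i mod L < L" for i using L by simp
  have "{e \<in> cycle_edges vs. v \<in> e} = {edge k, edge p}"
  proof (intro set_eqI iffI)
    fix e assume "e \<in> {e \<in> cycle_edges vs. v \<in> e}"
    then obtain i where i: "i < L" "e = edge i" "v \<in> e"
      by (auto simp: cycle_edges_def edge_def L_def)
    then have "k = i \<or> k = Suc i mod L"
      using eq[of k i] eq[of k "Suc i mod L"] k lt by (auto simp: edge_def)
    then show "e \<in> {edge k, edge p}"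
      using pred[of i] i by auto
  next
    fix e assume "e \<in> {edge k, edge p}"
    then show "e \<in> {e \<in> cycle_edges vs. v \<in> e}"
      using k p by (auto simp: cycle_edges_def edge_def L_def)
  qed
  moreover have "edge k \<noteq> edge p"
    using k p lt eq by (auto simp: edge_def doubleton_eq_iff)
  ultimately show ?thesis by simp
qed

section \<open>Horizontal and vertical edges of the grid\<close>

definition hedge :: "int \<Rightarrow> int \<Rightarrow> point set" where
  "hedge x y = {(x, y), (x + 1, y)}"

definition vedge :: "int \<Rightarrow> int \<Rightarrow> point set" where
  "vedge x y = {(x, y), (x, y + 1)}"

lemma hedge_eq_iff [simp]: "hedge x y = hedge x' y' \<longleftrightarrow> x = x' \<and> y = y'"
  by (auto simp: hedge_def doubleton_eq_iff)

lemma vedge_eq_iff [simp]: "vedge x y = vedge x' y' \<longleftrightarrow> x = x' \<and> y = y'"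
  by (auto simp: vedge_def doubleton_eq_iff)

lemma hedge_neq_vedge [simp]: "hedge x y \<noteq> vedge x' y'" "vedge x' y' \<noteq> hedge x y"
  by (auto simp: hedge_def vedge_def doubleton_eq_iff)

lemma mem_hedge: "(x, y) \<in> hedge x' y' \<longleftrightarrow> y' = y \<and> (x' = x \<or> x' = x - 1)"
  by (auto simp: hedge_def)

lemma mem_vedge: "(x, y) \<in> vedge x' y' \<longleftrightarrow> x' = x \<and> (y' = y \<or> y' = y - 1)"
  by (auto simp: vedge_def)

lemma grid_edges_eq:
  "grid_edges m n = (\<lambda>(x, y). hedge x y) ` ({1..<int m} \<times> {1..int n})
     \<union> (\<lambda>(x, y). vedge x y) ` ({1..int m} \<times> {1..<int n})"
proof -
  have "{{(x, y), (x + 1, y)} | x y. (x, y) \<in> grid_vertices m n \<and> (x + 1, y) \<in> grid_vertices m n}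
      = (\<lambda>(x, y). hedge x y) ` ({1..<int m} \<times> {1..int n})"
    by (fastforce simp: grid_vertices_def hedge_def)
  moreover have "{{(x, y), (x, y + 1)} | x y. (x, y) \<in> grid_vertices m n \<and> (x, y + 1) \<in> grid_vertices m n}
      = (\<lambda>(x, y). vedge x y) ` ({1..int m} \<times> {1..<int n})"
    by (fastforce simp: grid_vertices_def vedge_def)
  ultimately show ?thesis by (simp only: grid_edges_def)
qed

lemma hedge_in_grid_edges [simp]:
  "hedge x y \<in> grid_edges m n \<longleftrightarrow> 1 \<le> x \<and> x < int m \<and> 1 \<le> y \<and> y \<le> int n"
  by (auto simp: grid_edges_eq)

lemma vedge_in_grid_edges [simp]:
  "vedge x y \<in> grid_edges m n \<longleftrightarrow> 1 \<le> x \<and> x \<le> int m \<and> 1 \<le> y \<and> y < int n"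
  by (auto simp: grid_edges_eq)

text \<open>Cells are named by their lower left corner, and a cell is inside if the ray going left
  from it crosses an odd number of edges.\<close>

definition inside :: "point set set \<Rightarrow> int \<Rightarrow> int \<Rightarrow> bool" where
  "inside C x y \<longleftrightarrow> odd (card {k \<in> {1..x}. vedge k y \<in> C})"

text \<open>Even degrees make the crossing parity change across horizontal edges too; this stands in
  for the Jordan curve theorem.\<close>

definition even_degrees :: "'a set set \<Rightarrow> bool" where
  "even_degrees C \<longleftrightarrow> (\<forall>v. even (card {e \<in> C. v \<in> e}))"

lemma even_degrees_iff:
  assumes "C \<subseteq> grid_edges m n" "even_degrees C"
  shows "even (of_bool (hedge x y \<in> C) + of_bool (hedge (x - 1) y \<in> C)
    + of_bool (vedge x y \<in> C) + of_bool (vedge x (y - 1) \<in> C) :: nat)"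
proof -
  have "e \<in> {hedge x y, hedge (x - 1) y, vedge x y, vedge x (y - 1)}" if "e \<in> C" "(x, y) \<in> e" for e
  proof -
    have "e \<in> grid_edges m n" using assms(1) that(1) by blast
    then obtain x' y' where "e = hedge x' y' \<or> e = vedge x' y'"
      by (auto simp: grid_edges_eq)
    then show ?thesis using that(2) mem_hedge[of x y x' y'] mem_vedge[of x y x' y'] by blast
  qed
  then have "{e \<in> C. (x, y) \<in> e} = {hedge x y, hedge (x - 1) y, vedge x y, vedge x (y - 1)} \<inter> C"
    by (auto simp: mem_hedge mem_vedge)
  moreover have "distinct [hedge x y, hedge (x - 1) y, vedge x y, vedge x (y - 1)]"
    by simp
  ultimately show ?thesis
    using assms(2) card_of_bool4[of "hedge x y" "hedge (x - 1) y" "vedge x y" "vedge x (y - 1)" C]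
    unfolding even_degrees_def by metis
qed

text \<open>The rays from the two cells beside the edge differ in this edge alone.\<close>

lemma inside_vedge:
  assumes "C \<subseteq> grid_edges m n"
  shows "vedge x y \<in> C \<longleftrightarrow> inside C x y \<noteq> inside C (x - 1) y"
proof (cases "1 \<le> x")
  case True
  define S where "S = {k \<in> {1..x - 1}. vedge k y \<in> C}"
  have "S \<subseteq> {1..x - 1}" by (auto simp: S_def)
  then have "finite S" "x \<notin> S" by (auto dest: finite_subset)
  moreover have "{k \<in> {1..x}. vedge k y \<in> C} = (if vedge x y \<in> C then insert x S else S)"
    using True by (auto simp: S_def order_less_le)
  moreover have "inside C (x - 1) y \<longleftrightarrow> odd (card S)"
    unfolding inside_def S_def ..
  ultimately show ?thesis by (simp add: inside_def)
next
  case False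
  then have "vedge x y \<notin> C" using assms vedge_in_grid_edges[of x y m n] by auto
  then show ?thesis using False by (simp add: inside_def)
qed

lemma inside_left: "x \<le> 0 \<Longrightarrow> \<not> inside C x y"
  by (simp add: inside_def)

text \<open>Induction from the left border: the parities above and below the line change with the
  two vertical edges at (x + 1, y), and the even degree of that vertex makes the horizontal edges
  change in step.\<close>

lemma inside_hedge:
  assumes "C \<subseteq> grid_edges m n" "even_degrees C"
  shows "hedge x y \<in> C \<longleftrightarrow> inside C x y \<noteq> inside C x (y - 1)"
proof (cases "0 \<le> x")
  case True
  then show ?thesis
  proof (induction x rule: int_ge_induct)
    case base
    have "hedge 0 y \<notin> C" using assms(1) hedge_in_grid_edges[of 0 y m n] by auto
    then show ?case by (simp add: inside_left)
  next
    case (step x)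
    have "hedge (x + 1) y \<in> C \<longleftrightarrow>
        ((hedge x y \<in> C) \<noteq> ((vedge (x + 1) y \<in> C) \<noteq> (vedge (x + 1) (y - 1) \<in> C)))"
      using even_degrees_iff[OF assms, of "x + 1" y] by (auto split: if_splits)
    then show ?case
      using step inside_vedge[OF assms(1), of "x + 1" y] inside_vedge[OF assms(1), of "x + 1" "y - 1"]
      by auto
  qed
next
  case False
  then have "hedge x y \<notin> C"
    using assms(1) hedge_in_grid_edges[of x y m n] by auto
  then show ?thesis using False by (simp add: inside_left)
qed

text \<open>Beyond the left, lower and upper borders the ray meets no edge. On the right it crosses
  the grid, so the claim is carried up from row 0, as no horizontal edge lies in those
  columns.\<close>

lemma inside_inner:
  assumes C: "C \<subseteq> grid_edges m n" "even_degrees C" and inside: "inside C x y"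
  shows "0 < x \<and> x < int m \<and> 0 < y \<and> y < int n"
proof -
  have y: "0 < y" "y < int n" if "inside C x y" for x y
  proof -
    have "{k \<in> {1..x}. vedge k y \<in> C} \<noteq> {}"
      using that by (metis card.empty even_zero inside_def)
    then obtain k where "vedge k y \<in> C" by auto
    then have "vedge k y \<in> grid_edges m n" using C(1) by blast
    then show "0 < y" "y < int n" by simp_all
  qed
  have "\<not> inside C x y" if "int m \<le> x" "0 \<le> y" for y
    using that(2)
  proof (induction y rule: int_ge_induct)
    case base
    then show ?case using y(1) by force
  next
    case (step y)
    have "hedge x (y + 1) \<notin> C"
      using C(1) hedge_in_grid_edges[of x "y + 1" m n] that by auto
    then show ?case
      using inside_hedge[OF C, of x "y + 1"] step by simp
  qed
  then show ?thesis
    using inside inside_left[of x C y] y[OF inside] by force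
qed

lemma signature_cell:
  assumes C: "C \<subseteq> grid_edges m n" "even_degrees C"
    and "0 < x" "x < int m" "0 < y" "y < int n"
  shows "int (signature m n C (x, y)) = nbr_sum (\<lambda>x' y'. of_bool (inside C x' y' \<noteq> inside C x y)) x y"
proof -
  have "signature m n C (x, y) = card ({hedge x y, hedge x (y + 1), vedge x y, vedge (x + 1) y} \<inter> C)"
    using assms(3-) by (simp add: signature_def grid_cells_def hedge_def vedge_def)
  also have "\<dots> = of_bool (hedge x y \<in> C) + of_bool (hedge x (y + 1) \<in> C)
      + of_bool (vedge x y \<in> C) + of_bool (vedge (x + 1) y \<in> C)"
    by (rule card_of_bool4) simp
  finally show ?thesis
    by (simp add: nbr_sum_def inside_hedge[OF C] inside_vedge[OF C(1)])
qed

text \<open>Each edge of the difference borders exactly one cell with \<open>a = 1\<close>, and the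
  sum counts it from that cell.\<close>

lemma card_cycle_difference:
  fixes C\<^sub>1 C\<^sub>2 :: "point set set"
  assumes C: "C\<^sub>1 \<subseteq> grid_edges m n" "even_degrees C\<^sub>1" "C\<^sub>2 \<subseteq> grid_edges m n" "even_degrees C\<^sub>2"
    and a: "\<And>x y. a x y = of_bool (inside C\<^sub>1 x y \<noteq> inside C\<^sub>2 x y)"
    and supp: "\<And>x y. a x y \<noteq> 0 \<Longrightarrow> 0 < x \<and> x < int m \<and> 0 < y \<and> y < int n"
  shows "int (card (cycle_difference C\<^sub>1 C\<^sub>2))
    = (\<Sum>(x, y)\<in>{0..int m} \<times> {0..int n}. a x y * nbr_sum (\<lambda>x y. 1 - a x y) x y)"
proof -
  let ?K = "{0..int m} \<times> {0..int n}" and ?D = "cycle_difference C\<^sub>1 C\<^sub>2"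
  define z where "z = (\<lambda>x y. 1 - a x y)"
  have D_sub: "?D \<subseteq> grid_edges m n"
    using C by (auto simp: cycle_difference_def)
  define \<gamma> where "\<gamma> x y \<longleftrightarrow> inside C\<^sub>1 x y \<noteq> inside C\<^sub>2 x y" for x y
  have a\<gamma>: "a x y = of_bool (\<gamma> x y)" for x y
    unfolding a \<gamma>_def ..
  have "hedge x y \<in> ?D \<longleftrightarrow> \<gamma> x y \<noteq> \<gamma> x (y - 1)" for x y
    unfolding cycle_difference_def Un_iff Diff_iff inside_hedge[OF C(1,2)] inside_hedge[OF C(3,4)] \<gamma>_def
    by argo
  \<comment> \<open>One summand for each choice of the adjacent cell with \<open>a = 1\<close>;
    \<open>sum_shift\<close> later turns the second into a term for the upper neighbour.\<close>
  then have hD: "of_bool (hedge x y \<in> ?D) = a x y * z x (y - 1) + a x (y - 1) * z x y" for x y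
    by (simp add: z_def a\<gamma>)
  have "vedge x y \<in> ?D \<longleftrightarrow> \<gamma> x y \<noteq> \<gamma> (x - 1) y" for x y
    unfolding cycle_difference_def Un_iff Diff_iff inside_vedge[OF C(1)] inside_vedge[OF C(3)] \<gamma>_def
    by argo
  then have vD: "of_bool (vedge x y \<in> ?D) = a x y * z (x - 1) y + a (x - 1) y * z x y" for x y
    by (simp add: z_def a\<gamma>)
  let ?H = "?K \<inter> {(x, y). hedge x y \<in> ?D}" and ?V = "?K \<inter> {(x, y). vedge x y \<in> ?D}"
  define E\<^sub>h where "E\<^sub>h = (\<lambda>(x, y). hedge x y) ` ?H"
  define E\<^sub>v where "E\<^sub>v = (\<lambda>(x, y). vedge x y) ` ?V"
  have "?D \<subseteq> E\<^sub>h \<union> E\<^sub>v"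
  proof
    fix e assume e: "e \<in> ?D"
    with D_sub obtain x y where "e = hedge x y \<or> e = vedge x y" "(x, y) \<in> ?K"
      by (fastforce simp: grid_edges_eq)
    with e show "e \<in> E\<^sub>h \<union> E\<^sub>v" by (auto simp: E\<^sub>h_def E\<^sub>v_def)
  qed
  moreover have "E\<^sub>h \<union> E\<^sub>v \<subseteq> ?D" "E\<^sub>h \<inter> E\<^sub>v = {}"
    by (auto simp: E\<^sub>h_def E\<^sub>v_def)
  ultimately have D_eq: "?D = E\<^sub>h \<union> E\<^sub>v" "E\<^sub>h \<inter> E\<^sub>v = {}" by blast+
  have "finite E\<^sub>h" "finite E\<^sub>v" by (simp_all add: E\<^sub>h_def E\<^sub>v_def)
  with D_eq have "card ?D = card E\<^sub>h + card E\<^sub>v"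
    by (simp add: card_Un_disjoint)
  also have "\<dots> = card ?H + card ?V"
    by (simp add: E\<^sub>h_def E\<^sub>v_def card_image inj_on_def split_def prod_eq_iff)
  also have "int \<dots> = (\<Sum>(x, y)\<in>?K. of_bool (hedge x y \<in> ?D)) + (\<Sum>(x, y)\<in>?K. of_bool (vedge x y \<in> ?D))"
    by (simp add: split_def)
  also have "\<dots> = (\<Sum>(x, y)\<in>?K. a x y * nbr_sum z x y)"
    using sum_shift[of a "int m" "int n" 1 0 z, OF supp] sum_shift[of a "int m" "int n" 0 1 z, OF supp]
    by (simp add: hD vD nbr_sum_def distrib_left split_def sum.distrib)
  finally show ?thesis by (simp add: z_def)
qed

section \<open>Application to two cycles with equal signatures\<close>

lemma grid_cycle_even_degrees:
  assumes "grid_cycle m n C"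
  shows "C \<subseteq> grid_edges m n" "even_degrees C"
  using assms even_card_incident_cycle_edges by (auto simp: grid_cycle_def even_degrees_def)

theorem theorem5:
  fixes m n :: nat and C\<^sub>1 C\<^sub>2 :: "point set set"
  assumes "0 < m" and "0 < n"
    and "grid_cycle m n C\<^sub>1" and "grid_cycle m n C\<^sub>2"
    and "signature m n C\<^sub>1 = signature m n C\<^sub>2"
  shows "8 dvd card (cycle_difference C\<^sub>1 C\<^sub>2)"
proof -
  note C = grid_cycle_even_degrees[OF assms(3)] grid_cycle_even_degrees[OF assms(4)]
  define \<gamma> where "\<gamma> x y \<longleftrightarrow> inside C\<^sub>1 x y \<noteq> inside C\<^sub>2 x y" for x y
  define h :: "int \<Rightarrow> int \<Rightarrow> int"
    where "h x y = of_bool (inside C\<^sub>1 x y) + of_bool (inside C\<^sub>2 x y) - 1" for x y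
  have boundary: "\<not> inside C\<^sub>1 x y" "\<not> inside C\<^sub>2 x y" if "x \<in> {0, int m} \<or> y \<in> {0, int n}" for x y
    using that inside_inner[OF C(1,2), of x y] inside_inner[OF C(3,4), of x y] by auto
  define d :: "point set set \<Rightarrow> int \<Rightarrow> int \<Rightarrow> int \<Rightarrow> int \<Rightarrow> int"
    where "d C x y x' y' = of_bool (inside C x' y' \<noteq> inside C x y)" for C x y x' y'
  have balance: "nbr_sum (d C\<^sub>1 x y) x y = nbr_sum (d C\<^sub>2 x y) x y"
    if "0 < x" "x < int m" "0 < y" "y < int n" for x y
    using signature_cell[OF C(1,2) that] signature_cell[OF C(3,4) that] assms(5)
    unfolding d_def by simp
  have even_nbrs: "even (nbr_sum (\<lambda>x y. of_bool (\<gamma> x y)) x y)"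
    if "0 < x" "x < int m" "0 < y" "y < int n" for x y
  proof -
    define c :: "int \<Rightarrow> int \<Rightarrow> int" where "c = (\<lambda>x y. of_bool (\<gamma> x y))"
    \<comment> \<open>Modulo 2, \<open>c\<close> at a neighbour is \<open>c x y\<close> plus both
      values of \<open>d\<close>. Over four neighbours the copies of \<open>c x y\<close> add up to
      an even number and the \<open>d\<close> terms cancel by \<open>balance\<close>.\<close>
    have "even (c x' y' - (d C\<^sub>1 x y x' y' - d C\<^sub>2 x y x' y' + c x y))" for x' y'
      by (auto simp: \<gamma>_def c_def d_def)
    from this[of "x + 1" y] this[of "x - 1" y] this[of x "y + 1"] this[of x "y - 1"]
    have "even (nbr_sum c x y)"
      using balance[OF that] unfolding nbr_sum_def by presburger
    then show ?thesis by (simp only: c_def)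
  qed
  obtain w where w: "\<And>x y. w x y \<in> {-1, 0, 1 :: int}"
    "\<And>x y. w x y \<noteq> 0 \<longleftrightarrow> 0 < x \<and> x < int m \<and> 0 < y \<and> y < int n \<and> \<gamma> x y"
    "\<And>x y. 0 < x \<Longrightarrow> x < int m \<Longrightarrow> 0 < y \<Longrightarrow> y < int n \<Longrightarrow> nbr_sum w x y = 0"
  proof (rule harmonic_lift[of "int m" "int n" \<gamma>])
    show "\<not> \<gamma> x y" if "x \<in> {0, int m} \<or> y \<in> {0, int n}" for x y
      using boundary[OF that] by (simp add: \<gamma>_def)
  qed (use assms(1,2) even_nbrs in auto)
  have h_nbrs: "nbr_sum h x y = 0" if "w x y \<noteq> 0" for x y
  proof -
    \<comment> \<open>Where \<open>\<gamma>\<close> holds, exactly one cycle encloses the cell; the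
      sign \<open>s\<close> records which.\<close>
    define s :: int where "s = (if inside C\<^sub>1 x y then - 1 else 1)"
    have xy: "0 < x" "x < int m" "0 < y" "y < int n" "\<gamma> x y"
      using that w(2)[of x y] by auto
    have "s * h x' y' = d C\<^sub>1 x y x' y' - d C\<^sub>2 x y x' y'" for x' y'
      using xy(5) by (auto simp: \<gamma>_def h_def s_def d_def)
    then have "s * nbr_sum h x y = nbr_sum (d C\<^sub>1 x y) x y - nbr_sum (d C\<^sub>2 x y) x y"
      by (simp add: nbr_sum_def distrib_left)
    then show ?thesis
      using balance[OF xy(1-4)] by (simp add: s_def split: if_splits)
  qed
  have "8 dvd (\<Sum>(x, y)\<in>{0..int m} \<times> {0..int n}. (w x y)\<^sup>2 * nbr_sum (\<lambda>x y. 1 - (w x y)\<^sup>2) x y)"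
    using w boundary h_nbrs by (intro eight_dvd_sum_nbr_sum[where h = h]) (auto simp: h_def)
  also have "\<dots> = int (card (cycle_difference C\<^sub>1 C\<^sub>2))"
  proof (rule card_cycle_difference[OF C, symmetric])
    show "(w x y)\<^sup>2 = of_bool (inside C\<^sub>1 x y \<noteq> inside C\<^sub>2 x y)" for x y
      using w(1,2)[of x y] inside_inner[OF C(1,2), of x y] inside_inner[OF C(3,4), of x y]
      by (auto simp: \<gamma>_def)
  qed (use w(2) in auto)
  finally show ?thesis
    by (metis int_dvd_int_iff of_nat_numeral)
qed

end
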